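(* Let $n\ge 1$ and let $(A(t))_{t\in\mathbb{N}}$ be a sequence of nonnegative $n\times n$ real matrices all of whose diagonal entries are positive. Then there exists a sequence of natural numbers $0<t_0<t_1<t_2<\dots$ such that for the backward accumulations $A(t,s)=A(t-1)\cdots A(s)$ and for all $i\in\mathbb{N}$ it holds that $$A(t_{i+1},t_i)\sim A(t_1,t_0).$$ Thus all the matrices $A(t_{i+1},t_i)$, $i\in\mathbb{N}$, can be brought to the same Gantmacher form (by the same simultaneous row and column permutation). Furthermore, for all $i\in\mathbb{N}$, all diagonal Gantmacher blocks of $A(t_{i+1},t_i)$ are (entrywise) positive, and each nondiagonal Gantmacher block of $A(t_{i+1},t_i)$ is either (entrywise) positive or zero.
   Context: $\mathbb{N}=\{0,1,2,\dots\}$ and $\underline{n}=\{1,\dots,n\}$. For natural numbers $s<t$ the backward accumulation is $A(t,s):=A(t-1)A(t-2)\cdots A(s)$ (so $A(s+1,s)=A(s)$), and $A(s,s)$ is the identity matrix. Two nonnegative matrices $A,B$ of the same size are of the same type, written $A\sim B$, if for all $i,j$: $a_{ij}>0\Leftrightarrow b_{ij}>0$. Let $A$ be a nonnegative $n\times n$ matrix with positive diagonal. For $i,j\in\underline{n}$ write $i\rightarrow j$ if there is a sequence of indices $i=i_1,\dots,i_k=j$ with $a_{i_l,i_{l+1}}>0$ for all $l\in\{1,\dots,k-1\}$. Indices $i,j$ communicate if $i\rightarrow j$ and $j\rightarrow i$; because of the positive diagonal this is an equivalence relation, and its equivalence classes are denoted $\mathcal{I}_1,\dots,\mathcal{I}_p$.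 An index $i$ is essential if $i\rightarrow j$ implies $j\rightarrow i$ for every $j\in\underline{n}$, and inessential otherwise; these notions extend to classes. For classes, $\mathcal{J}\rightarrow\mathcal{I}$ means that there is a path from an index of $\mathcal{J}$ to an index of $\mathcal{I}$. Number the classes so that the essential classes $\mathcal{I}_1,\dots,\mathcal{I}_g$ come first, followed by the inessential classes $\mathcal{I}_{g+1},\dots,\mathcal{I}_p$, with a class $\mathcal{I}$ placed before a different class $\mathcal{J}$ if $\mathcal{J}\rightarrow\mathcal{I}$. Simultaneously permuting rows and columns of $A$ according to this order gives the Gantmacher form of $A$, a lower block triangular matrix. Its diagonal Gantmacher blocks are $A_k=A_{[\mathcal{I}_k,\mathcal{I}_k]}$, $k=1,\dots,p$, and its nondiagonal Gantmacher blocks are $A_{k,l}=A_{[\mathcal{I}_k,\mathcal{I}_l]}$ for $k=g+1,\dots,p$ and $l=1,\dots,k-1$. All other blocks are zero. Here $A_{[\mathcal{I},\mathcal{J}]}$ denotes the submatrix with rows indexed by $\mathcal{I}$ and columns indexed by $\mathcal{J}$. The block structure depends only on the type of $A$. *)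

theory Defs
  imports
    "Jordan_Normal_Form.Matrix"
    "Jordan_Normal_Form.DL_Submatrix"
    "HOL-Combinatorics.Permutations"
begin

text \<open>
  The index set is \<open>{..<n}\<close> instead of \<open>{1..n}\<close>, following the matrix library;
  likewise classes and blocks are numbered from \<open>0\<close>.
\<close>

definition nonneg_mat :: "real mat \<Rightarrow> bool" where
  "nonneg_mat A \<longleftrightarrow> (\<forall>i<dim_row A. \<forall>j<dim_col A. A $$ (i, j) \<ge> 0)"

definition pos_mat :: "real mat \<Rightarrow> bool" where
  "pos_mat A \<longleftrightarrow> (\<forall>i<dim_row A. \<forall>j<dim_col A. A $$ (i, j) > 0)"

definition is_zero_mat :: "real mat \<Rightarrow> bool" where
  "is_zero_mat A \<longleftrightarrow> A = 0\<^sub>m (dim_row A) (dim_col A)"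

definition pos_diagonal :: "real mat \<Rightarrow> bool" where
  "pos_diagonal A \<longleftrightarrow> (\<forall>i<dim_row A. A $$ (i, i) > 0)"

definition same_type :: "real mat \<Rightarrow> real mat \<Rightarrow> bool" where
  "same_type A B \<longleftrightarrow>
     dim_row A = dim_row B \<and> dim_col A = dim_col B \<and>
     (\<forall>i<dim_row A. \<forall>j<dim_col A. A $$ (i, j) > 0 \<longleftrightarrow> B $$ (i, j) > 0)"

text \<open>
  \<open>backward_acc n A t s\<close> is \<open>A (t - 1) * A (t - 2) * \<dots> * A s\<close> for \<open>s \<le> t\<close>,
  the identity for \<open>s = t\<close>.
\<close>

definition backward_acc :: "nat \<Rightarrow> (nat \<Rightarrow> real mat) \<Rightarrow> nat \<Rightarrow> nat \<Rightarrow> real mat" where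
  "backward_acc n A t s = foldr (\<lambda>r M. A r * M) (rev [s..<t]) (1\<^sub>m n)"

text \<open>
  The relations below are meant for square matrices.  A path \<open>i\<^sub>1, \<dots>, i\<^sub>k\<close> may have
  \<open>k = 1\<close>, hence the reflexive closure; for a positive diagonal it makes no difference.
\<close>

definition pos_edges :: "real mat \<Rightarrow> (nat \<times> nat) set" where
  "pos_edges A = {(i, j). i < dim_row A \<and> j < dim_row A \<and> A $$ (i, j) > 0}"

definition reaches :: "real mat \<Rightarrow> nat \<Rightarrow> nat \<Rightarrow> bool" where
  "reaches A i j \<longleftrightarrow> (i, j) \<in> (pos_edges A)\<^sup>*"

definition communicates :: "real mat \<Rightarrow> nat \<Rightarrow> nat \<Rightarrow> bool" where
  "communicates A i j \<longleftrightarrow> reaches A i j \<and> reaches A j i"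

definition comm_classes :: "real mat \<Rightarrow> nat set set" where
  "comm_classes A =
     {..<dim_row A} // {(i, j). i < dim_row A \<and> j < dim_row A \<and> communicates A i j}"

definition essential :: "real mat \<Rightarrow> nat \<Rightarrow> bool" where
  "essential A i \<longleftrightarrow> (\<forall>j<dim_row A. reaches A i j \<longrightarrow> reaches A j i)"

text \<open>All indices of a communication class are essential as soon as one of them is.\<close>

definition essential_class :: "real mat \<Rightarrow> nat set \<Rightarrow> bool" where
  "essential_class A I \<longleftrightarrow> (\<forall>i\<in>I. essential A i)"

definition class_reaches :: "real mat \<Rightarrow> nat set \<Rightarrow> nat set \<Rightarrow> bool" where
  "class_reaches A J I \<longleftrightarrow> (\<exists>j\<in>J. \<exists>i\<in>I. reaches A j i)"

definition num_essential_classes :: "real mat \<Rightarrow> nat" where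
  "num_essential_classes A = card {I \<in> comm_classes A. essential_class A I}"

definition gantmacher_numbering :: "real mat \<Rightarrow> nat set list \<Rightarrow> bool" where
  "gantmacher_numbering A Is \<longleftrightarrow>
     distinct Is \<and> set Is = comm_classes A \<and>
     (\<forall>k<length Is. essential_class A (Is ! k) \<longleftrightarrow> k < num_essential_classes A) \<and>
     (\<forall>k<length Is. \<forall>l<length Is.
        k \<noteq> l \<and> class_reaches A (Is ! l) (Is ! k) \<longrightarrow> k < l)"

text \<open>
  \<open>\<sigma>\<close> sends a position in the Gantmacher form to the original index placed there.
  Positions are arranged class by class; the order inside a class is arbitrary.
\<close>

definition gantmacher_permutation :: "real mat \<Rightarrow> nat set list \<Rightarrow> (nat \<Rightarrow> nat) \<Rightarrow> bool" where
  "gantmacher_permutation A Is \<sigma> \<longleftrightarrow>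
     gantmacher_numbering A Is \<and> \<sigma> permutes {..<dim_row A} \<and>
     (\<forall>k<length Is. \<forall>l<length Is. \<forall>i<dim_row A. \<forall>j<dim_row A.
        k < l \<and> \<sigma> i \<in> Is ! k \<and> \<sigma> j \<in> Is ! l \<longrightarrow> i < j)"

definition gantmacher_form :: "real mat \<Rightarrow> (nat \<Rightarrow> nat) \<Rightarrow> real mat" where
  "gantmacher_form A \<sigma> = mat (dim_row A) (dim_col A) (\<lambda>(i, j). A $$ (\<sigma> i, \<sigma> j))"

definition gantmacher_block :: "real mat \<Rightarrow> nat set list \<Rightarrow> nat \<Rightarrow> nat \<Rightarrow> real mat" where
  "gantmacher_block A Is k l = submatrix A (Is ! k) (Is ! l)"

text \<open>The remaining blocks vanish, so the Gantmacher form is lower block triangular.\<close>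

lemma gantmacher_other_blocks_zero:
  assumes A: "A \<in> carrier_mat n n" "nonneg_mat A" and num: "gantmacher_numbering A Is"
    and kl: "k < length Is" "l < length Is" "k \<noteq> l" "k < l \<or> k < num_essential_classes A"
    and ij: "i \<in> Is ! k" "j \<in> Is ! l"
  shows "A $$ (i, j) = 0"
proof (rule ccontr)
  assume nz: "A $$ (i, j) \<noteq> 0"
  have dims: "dim_row A = n" "dim_col A = n" using A by auto
  have "Is ! k \<in> comm_classes A" "Is ! l \<in> comm_classes A"
    using num kl nth_mem unfolding gantmacher_numbering_def by blast+
  then have lt: "i < n" "j < n"
    using ij unfolding comm_classes_def quotient_def dims by blast+
  have "A $$ (i, j) \<ge> 0" using A(2) lt dims unfolding nonneg_mat_def by simp
  with nz have pos: "A $$ (i, j) > 0" by simp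
  have r: "reaches A i j"
    unfolding reaches_def by (intro r_into_rtrancl) (simp add: pos_edges_def dims lt pos)
  then have "class_reaches A (Is ! k) (Is ! l)" using ij unfolding class_reaches_def by blast
  then have "l < k" using num kl unfolding gantmacher_numbering_def by blast
  then have "essential A i"
    using num kl ij unfolding gantmacher_numbering_def essential_class_def
    by (meson less_asym)
  then have "reaches A j i" using r lt unfolding essential_def dims by blast
  then have "class_reaches A (Is ! l) (Is ! k)" using ij unfolding class_reaches_def by blast
  then have "k < l" using num kl unfolding gantmacher_numbering_def by blast
  with \<open>l < k\<close> show False by simp
qed

end

theory Submission
  imports Defs
begin

text \<open>
  Since only the type of the matrices matters, each accumulation is replaced by its positivity
  relation \<open>R t s = pos_edges (backward_acc n A t s)\<close>: by nonnegativity products become relational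
  compositions (\<open>pos_edges_mult\<close>), and by the positive diagonals all these relations are reflexive.
  So \<open>R t s\<close> can only grow when the window from \<open>s\<close> to \<open>t\<close> is enlarged at either end.  As there are
  finitely many relations on \<open>{..<n}\<close>, for fixed \<open>s\<close> it reaches a limit \<open>L s\<close> as \<open>t\<close> grows.  These
  limits shrink as \<open>s\<close> grows, hence equal one relation \<open>P\<close> from some point on.  Starting beyond
  that point and always taking \<open>t (Suc i)\<close> so late that \<open>R\<close> has reached its limit \<open>P\<close>, all
  accumulations obtain the type \<open>P\<close>.  Moreover the window from \<open>t 0\<close> to \<open>t 2\<close> has both type \<open>P\<close>, by the
  choice of \<open>t 1\<close>, and type \<open>P O P\<close>, being composed of two windows.  Hence \<open>P\<close> is transitive
  (\<open>eventually_constant_transitive_windows\<close>).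

  Reachability for a reflexive and transitive \<open>P\<close> is \<open>P\<close> itself, so one positive entry in a block
  makes the whole block positive: everything in the row class reaches the row of that entry, and its
  column reaches everything in the column class.  This is the claim on the Gantmacher blocks.

  A Gantmacher numbering exists for every square matrix: number the classes by increasing size of
  the set of indices that they reach, with essential classes counted as \<open>0\<close>.
\<close>

section \<open>Windows of a composition of reflexive relations\<close>

lemma antimono_finite_sets_eventually_constant:
  fixes E :: "nat \<Rightarrow> 'a set"
  assumes fin: "\<And>s. finite (E s)" and anti: "\<And>s t. s \<le> t \<Longrightarrow> E t \<subseteq> E s"
  shows "\<exists>N. \<forall>t\<ge>N. E t = E N"
proof -
  obtain N where N: "\<And>t. card (E N) \<le> card (E t)"
    using ex_has_least_nat[of "\<lambda>_. True" 0 "\<lambda>t. card (E t)"] by auto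
  have "E t = E N" if "t \<ge> N" for t
    using card_seteq[OF fin anti[OF that] N] .
  then show ?thesis by blast
qed

lemma mono_finite_sets_eventually_constant:
  fixes E :: "nat \<Rightarrow> 'a set"
  assumes fin: "finite F" and sub: "\<And>s. E s \<subseteq> F" and mono: "\<And>s t. s \<le> t \<Longrightarrow> E s \<subseteq> E t"
  shows "\<exists>N. \<forall>t\<ge>N. E t = E N"
proof -
  have "\<exists>N. \<forall>t\<ge>N. F - E t = F - E N"
    by (rule antimono_finite_sets_eventually_constant) (use fin mono in auto)
  then obtain N where N: "\<And>t. t \<ge> N \<Longrightarrow> F - E t = F - E N" by blast
  have "E t = F - (F - E t)" for t using sub by blast
  then have "E t = E N" if "t \<ge> N" for t using N[OF that] by metis
  then show ?thesis by blast
qed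

text \<open>
  Transitivity costs no additional choice: two consecutive windows, and the window that they make
  up, all reach the same limit.
\<close>

lemma eventually_constant_transitive_windows:
  fixes R :: "nat \<Rightarrow> nat \<Rightarrow> ('a \<times> 'a) set"
  assumes V: "finite V"
    and sub: "\<And>t s. s \<le> t \<Longrightarrow> R t s \<subseteq> V \<times> V"
    and rfl: "\<And>t s. s \<le> t \<Longrightarrow> Id_on V \<subseteq> R t s"
    and comp: "\<And>t u s. s \<le> u \<Longrightarrow> u \<le> t \<Longrightarrow> R t s = R t u O R u s"
  shows "\<exists>(t :: nat \<Rightarrow> nat) P. 0 < t 0 \<and> strict_mono t \<and> (\<forall>i. R (t (Suc i)) (t i) = P) \<and> trans P"
proof -
  have grow_end: "R u s \<subseteq> R t s" if "s \<le> u" "u \<le> t" for s u t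
    unfolding comp[OF that] using rfl[OF that(2)] sub[OF that(1)] by fast
  have grow_start: "R t u \<subseteq> R t s" if "s \<le> u" "u \<le> t" for s u t
    unfolding comp[OF that] using rfl[OF that(1)] sub[OF that(2)] by fast
  have "\<exists>d. \<forall>t\<ge>d. R (s + t) s = R (s + d) s" for s
    by (rule mono_finite_sets_eventually_constant[of "V \<times> V"]) (use V sub grow_end in auto)
  then obtain d where d: "\<And>s t. d s \<le> t \<Longrightarrow> R (s + t) s = R (s + d s) s" by metis
  define L where "L s = R (s + d s) s" for s
  have L: "R t s = L s" if "s + d s \<le> t" for s t
    using d[of s "t - s"] that unfolding L_def by simp
  have "L u \<subseteq> L s" if "s \<le> u" for s u
  proof -
    define t where "t = u + d u + d s"
    have "R t u = L u" "R t s = L s" using L that unfolding t_def by auto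
    then show ?thesis using grow_start[of s u t] that unfolding t_def by simp
  qed
  moreover have "finite (L s)" for s
    unfolding L_def by (rule finite_subset[OF sub]) (use V in auto)
  ultimately obtain N where N: "\<And>s. N \<le> s \<Longrightarrow> L s = L N"
    using antimono_finite_sets_eventually_constant[of L] by blast
  define P where "P = L N"
  define t where "t = rec_nat (Suc N) (\<lambda>_ s. Suc (s + d s))"
  have t0: "t 0 = Suc N" and tS: "t (Suc i) = Suc (t i + d (t i))" for i
    unfolding t_def by simp_all
  have sm: "strict_mono t" by (simp add: strict_mono_Suc_iff tS)
  have "N \<le> t i" for i by (induction i) (simp_all add: t0 tS)
  then have "L (t i) = P" for i unfolding P_def by (rule N)
  then have P: "R r (t i) = P" if "t (Suc i) \<le> r" for r i
    using L[of "t i" r] that by (simp add: tS)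
  have "P O P \<subseteq> P"
  proof -
    have "R (t 2) (t 0) = R (t 2) (t 1) O R (t 1) (t 0)"
      by (rule comp) (simp_all add: strict_mono_less_eq[OF sm])
    then show ?thesis
      using P[of 0 "t 2"] P[of 1 "t 2"] P[of 0 "t 1"] strict_mono_less_eq[OF sm]
      by (simp add: numeral_2_eq_2)
  qed
  then have "trans P" using relcompI[of _ _ P _ P] by (intro transI) blast
  then show ?thesis using sm P t0 by (intro exI[of _ t] exI[of _ P]) simp
qed

section \<open>Positivity relations of accumulations\<close>

lemma nonneg_mat_mult:
  assumes "A \<in> carrier_mat n n" "B \<in> carrier_mat n n" "nonneg_mat A" "nonneg_mat B"
  shows "nonneg_mat (A * B)"
  using assms unfolding nonneg_mat_def
  by (auto simp: scalar_prod_def intro!: sum_nonneg mult_nonneg_nonneg)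

lemma pos_edges_mult:
  assumes A: "A \<in> carrier_mat n n" "nonneg_mat A" and B: "B \<in> carrier_mat n n" "nonneg_mat B"
  shows "pos_edges (A * B) = pos_edges A O pos_edges B"
proof -
  have "(A * B) $$ (i, j) > 0 \<longleftrightarrow> (\<exists>k<n. A $$ (i, k) > 0 \<and> B $$ (k, j) > 0)"
    if ij: "i < n" "j < n" for i j
  proof -
    have eq: "(A * B) $$ (i, j) = (\<Sum>k<n. A $$ (i, k) * B $$ (k, j))"
      using A B ij by (auto simp: scalar_prod_def lessThan_atLeast0)
    have nn: "A $$ (i, k) \<ge> 0" "B $$ (k, j) \<ge> 0" if "k < n" for k
      using A B ij that unfolding nonneg_mat_def by auto
    have "(\<Sum>k<n. A $$ (i, k) * B $$ (k, j)) > 0 \<longleftrightarrow> (\<exists>k<n. A $$ (i, k) * B $$ (k, j) \<noteq> 0)"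
      using sum_nonneg_eq_0_iff[of "{..<n}" "\<lambda>k. A $$ (i, k) * B $$ (k, j)"]
        sum_nonneg[of "{..<n}" "\<lambda>k. A $$ (i, k) * B $$ (k, j)"] nn
      by (auto simp: less_le)
    then show ?thesis unfolding eq using nn by (auto simp: less_le)
  qed
  then show ?thesis using A B unfolding pos_edges_def by auto
qed

lemma same_type_iff_pos_edges:
  assumes "A \<in> carrier_mat n n" "B \<in> carrier_mat n n"
  shows "same_type A B \<longleftrightarrow> pos_edges A = pos_edges B"
  using assms unfolding same_type_def pos_edges_def by auto

lemma backward_acc_refl: "backward_acc n A s s = 1\<^sub>m n"
  by (simp add: backward_acc_def)

lemma backward_acc_Suc:
  "s \<le> t \<Longrightarrow> backward_acc n A (Suc t) s = A t * backward_acc n A t s"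
  by (simp add: backward_acc_def)

context
  fixes n :: nat and A :: "nat \<Rightarrow> real mat"
  assumes A: "\<And>t. A t \<in> carrier_mat n n"
begin

lemma backward_acc_carrier: "s \<le> t \<Longrightarrow> backward_acc n A t s \<in> carrier_mat n n"
  by (induction t rule: dec_induct) (simp_all add: backward_acc_refl backward_acc_Suc mult_carrier_mat[OF A])

lemma backward_acc_split:
  assumes "s \<le> u" "u \<le> t"
  shows "backward_acc n A t s = backward_acc n A t u * backward_acc n A u s"
  using assms(2)
proof (induction t rule: dec_induct)
  case base
  then show ?case using backward_acc_carrier[OF assms(1)] by (simp add: backward_acc_refl)
next
  case (step t)
  then show ?case
    using backward_acc_carrier[OF assms(1)] backward_acc_carrier[OF step(1)] A[of t] assms(1)
    by (simp add: backward_acc_Suc assoc_mult_mat[of _ n n _ n _ n])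
qed

lemma backward_acc_nonneg:
  assumes "\<And>t. nonneg_mat (A t)" and "s \<le> t"
  shows "nonneg_mat (backward_acc n A t s)"
  using assms(2)
proof (induction t rule: dec_induct)
  case base
  then show ?case by (simp add: backward_acc_refl nonneg_mat_def)
next
  case (step t)
  then show ?case
    by (simp add: backward_acc_Suc nonneg_mat_mult[OF A backward_acc_carrier] assms(1))
qed

lemma backward_acc_edges_refl:
  assumes nn: "\<And>t. nonneg_mat (A t)" and pd: "\<And>t. pos_diagonal (A t)" and "s \<le> t"
  shows "Id_on {..<n} \<subseteq> pos_edges (backward_acc n A t s)"
  using assms(3)
proof (induction t rule: dec_induct)
  case base
  then show ?case by (auto simp: backward_acc_refl pos_edges_def)
next
  case (step t)
  have "Id_on {..<n} \<subseteq> pos_edges (A t)"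
    using A[of t] pd[of t] by (auto simp: pos_edges_def pos_diagonal_def)
  then show ?case
    using step by (auto simp: backward_acc_Suc
      pos_edges_mult[OF A nn backward_acc_carrier backward_acc_nonneg[OF nn]])
qed

end

section \<open>Existence of a Gantmacher form\<close>

lemma ex_list_ordered_by_key:
  fixes f :: "'a \<Rightarrow> nat"
  assumes "finite S"
  shows "\<exists>xs. distinct xs \<and> set xs = S \<and>
    (\<forall>k<length xs. \<forall>l<length xs. f (xs ! k) < f (xs ! l) \<longrightarrow> k < l)"
proof -
  obtain ys where ys: "set ys = S" "distinct ys" using finite_distinct_list[OF assms] by blast
  define xs where "xs = sort_key f ys"
  have "k < l" if "k < length xs" "l < length xs" "f (xs ! k) < f (xs ! l)" for k l
  proof (rule ccontr)
    assume "\<not> k < l"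
    then have "map f xs ! l \<le> map f xs ! k"
      by (intro sorted_nth_mono) (use that in \<open>simp_all add: xs_def\<close>)
    then show False using that by simp
  qed
  then show ?thesis using ys by (intro exI[of _ xs]) (auto simp: xs_def)
qed

lemma reaches_refl: "reaches A i i"
  and reaches_trans: "reaches A i j \<Longrightarrow> reaches A j k \<Longrightarrow> reaches A i k"
  unfolding reaches_def by auto

lemma equiv_communicates:
  "equiv {..<d} {(i, j). i < d \<and> j < d \<and> communicates A i j}"
  unfolding equiv_def refl_on_def sym_def trans_def communicates_def
  by (auto intro: reaches_refl reaches_trans)

lemma comm_class_subset: "I \<in> comm_classes A \<Longrightarrow> I \<subseteq> {..<dim_row A}"
  unfolding comm_classes_def quotient_def by blast

lemma comm_class_nonempty: "I \<in> comm_classes A \<Longrightarrow> I \<noteq> {}"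
  unfolding comm_classes_def using in_quotient_imp_non_empty[OF equiv_communicates] by blast

lemma comm_class_eq_iff:
  assumes "I \<in> comm_classes A" "J \<in> comm_classes A" "i \<in> I" "j \<in> J"
  shows "I = J \<longleftrightarrow> communicates A i j"
  using quotient_eq_iff[OF equiv_communicates assms[unfolded comm_classes_def]]
    assms comm_class_subset[of _ A] by fastforce

lemma Union_comm_classes: "\<Union> (comm_classes A) = {..<dim_row A}"
  unfolding comm_classes_def by (rule Union_quotient[OF equiv_communicates])

lemma finite_comm_classes: "finite (comm_classes A)"
  unfolding comm_classes_def by (rule finite_quotient) auto

text \<open>
  The value \<open>0\<close> puts the essential classes first, although they may reach more indices than some
  inessential ones do.
\<close>

definition class_rank :: "real mat \<Rightarrow> nat set \<Rightarrow> nat" where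
  "class_rank A I = (if essential_class A I then 0
     else card {j. j < dim_row A \<and> class_reaches A I {j}})"

lemma class_rank_eq_0_iff:
  assumes "I \<in> comm_classes A"
  shows "class_rank A I = 0 \<longleftrightarrow> essential_class A I"
proof -
  obtain i where "i \<in> I" using comm_class_nonempty[OF assms] by blast
  then have "i \<in> {j. j < dim_row A \<and> class_reaches A I {j}}"
    using comm_class_subset[OF assms] reaches_refl[of A i] unfolding class_reaches_def by blast
  then show ?thesis unfolding class_rank_def by (auto simp: card_eq_0_iff)
qed

text \<open>
  For essential \<open>I\<close> only \<open>J\<close> being inessential matters.  Otherwise everything reached from \<open>I\<close> is reached from \<open>J\<close>, but \<open>J\<close> itself is not reached back from \<open>I\<close>; and an
  essential \<open>J\<close> reaches no other class.
\<close>

lemma class_rank_less: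
  assumes I: "I \<in> comm_classes A" and J: "J \<in> comm_classes A" and ne: "I \<noteq> J"
    and JI: "class_reaches A J I"
  shows "class_rank A I < class_rank A J"
proof -
  obtain j i where ji: "j \<in> J" "i \<in> I" "reaches A j i"
    using JI unfolding class_reaches_def by blast
  have lt: "j < dim_row A" "i < dim_row A"
    using ji comm_class_subset[OF I] comm_class_subset[OF J] by auto
  have not_back: "\<not> reaches A i j"
    using ji comm_class_eq_iff[OF I J ji(2,1)] ne unfolding communicates_def by blast
  then have J_iness: "\<not> essential_class A J"
    using ji lt unfolding essential_class_def essential_def by blast
  show ?thesis
  proof (cases "essential_class A I")
    case True
    then show ?thesis
      using J_iness class_rank_eq_0_iff[OF I] class_rank_eq_0_iff[OF J] by simp
  next
    case False
    have "{k. k < dim_row A \<and> class_reaches A I {k}} \<subset> {k. k < dim_row A \<and> class_reaches A J {k}}"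
    proof
      show "{k. k < dim_row A \<and> class_reaches A I {k}} \<subseteq> {k. k < dim_row A \<and> class_reaches A J {k}}"
      proof clarify
        fix k assume "class_reaches A I {k}"
        then obtain i' where i': "i' \<in> I" "reaches A i' k" unfolding class_reaches_def by blast
        have "reaches A i i'"
          using comm_class_eq_iff[OF I I ji(2) i'(1)] unfolding communicates_def by blast
        then have "reaches A j k" using ji(3) i'(2) reaches_trans by blast
        then show "class_reaches A J {k}" using ji unfolding class_reaches_def by blast
      qed
      have "\<not> class_reaches A I {j}"
      proof
        assume "class_reaches A I {j}"
        then obtain i' where i': "i' \<in> I" "reaches A i' j" unfolding class_reaches_def by blast
        have "reaches A i i'"
          using comm_class_eq_iff[OF I I ji(2) i'(1)] unfolding communicates_def by blast
        then show False using i'(2) not_back reaches_trans by blast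
      qed
      moreover have "class_reaches A J {j}"
        using ji reaches_refl unfolding class_reaches_def by blast
      ultimately show "{k. k < dim_row A \<and> class_reaches A I {k}} \<noteq>
          {k. k < dim_row A \<and> class_reaches A J {k}}"
        using lt by blast
    qed
    then have "card {k. k < dim_row A \<and> class_reaches A I {k}}
        < card {k. k < dim_row A \<and> class_reaches A J {k}}"
      by (intro psubset_card_mono) auto
    then show ?thesis using False J_iness by (simp add: class_rank_def)
  qed
qed

lemma gantmacher_numbering_exists: "\<exists>Is. gantmacher_numbering A Is"
proof -
  obtain Is where dist: "distinct Is" and set: "set Is = comm_classes A"
    and ord: "\<And>k l. k < length Is \<Longrightarrow> l < length Is \<Longrightarrow>
      class_rank A (Is ! k) < class_rank A (Is ! l) \<Longrightarrow> k < l"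
    using ex_list_ordered_by_key[OF finite_comm_classes, of A "class_rank A"] by blast
  have cl: "Is ! k \<in> comm_classes A" if "k < length Is" for k
    using that set nth_mem by blast
  define K where "K = {k. k < length Is \<and> essential_class A (Is ! k)}"
  have "bij_betw ((!) Is) K {I \<in> comm_classes A. essential_class A I}"
    unfolding bij_betw_def K_def set[symmetric]
    using inj_on_nth[OF dist] by (auto simp: in_set_conv_nth)
  then have cardK: "card K = num_essential_classes A"
    unfolding num_essential_classes_def by (rule bij_betw_same_card)
  \<comment> \<open>The positions of rank \<open>0\<close> are an initial segment, whose length is therefore their number.\<close>
  have down: "l \<in> K" if "k \<in> K" "l < k" for k l
  proof (rule ccontr)
    assume "l \<notin> K"
    then have "class_rank A (Is ! k) < class_rank A (Is ! l)"
      using that class_rank_eq_0_iff[OF cl] unfolding K_def by (metis (mono_tags, lifting)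
        gr0I less_trans mem_Collect_eq)
    then show False using ord[of k l] that unfolding K_def by simp
  qed
  define m where "m = (LEAST m. m \<notin> K)"
  have "m \<notin> K" unfolding m_def by (rule LeastI[of _ "length Is"]) (simp add: K_def)
  then have below: "k < m" if "k \<in> K" for k
    using down[OF that, of m] that by (cases k m rule: linorder_cases) auto
  have "l \<in> K" if "l < m" for l using not_less_Least that unfolding m_def by blast
  then have "K = {..<m}" using below by blast
  then have in_K_iff: "k \<in> K \<longleftrightarrow> k < num_essential_classes A" for k
    unfolding cardK[symmetric] by simp
  have ess_iff: "essential_class A (Is ! k) \<longleftrightarrow> k < num_essential_classes A" if "k < length Is" for k
    using in_K_iff[of k] that unfolding K_def by simp
  have "k < l" if "k < length Is" "l < length Is" "k \<noteq> l"
    "class_reaches A (Is ! l) (Is ! k)" for k l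
  proof (rule ord[OF that(1,2) class_rank_less[OF cl[OF that(1)] cl[OF that(2)] _ that(4)]])
    show "Is ! k \<noteq> Is ! l" using that by (simp add: nth_eq_iff_index_eq[OF dist])
  qed
  then show ?thesis unfolding gantmacher_numbering_def using dist set ess_iff by blast
qed

lemma gantmacher_permutation_exists: "\<exists>Is \<sigma>. gantmacher_permutation A Is \<sigma>"
proof -
  obtain Is where Is: "gantmacher_numbering A Is" using gantmacher_numbering_exists by blast
  then have dist: "distinct Is" and set: "set Is = comm_classes A"
    unfolding gantmacher_numbering_def by auto
  define pos where "pos i = (THE k. k < length Is \<and> i \<in> Is ! k)" for i
  have pos: "pos i = k" if "k < length Is" "i \<in> Is ! k" for i k
    unfolding pos_def
  proof (rule the_equality)
    fix l assume l: "l < length Is \<and> i \<in> Is ! l"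
    then have "Is ! l = Is ! k"
      using comm_class_eq_iff[of "Is ! l" A "Is ! k" i i] that set nth_mem reaches_refl
      unfolding communicates_def by metis
    then show "l = k" using l that dist by (simp add: nth_eq_iff_index_eq)
  qed (use that in auto)
  obtain xs where xs: "distinct xs" "set xs = {..<dim_row A}"
    and ord: "\<And>i j. i < length xs \<Longrightarrow> j < length xs \<Longrightarrow> pos (xs ! i) < pos (xs ! j) \<Longrightarrow> i < j"
    using ex_list_ordered_by_key[of "{..<dim_row A}" pos] by blast
  have len: "length xs = dim_row A" using xs distinct_card by fastforce
  define \<sigma> where "\<sigma> i = (if i < dim_row A then xs ! i else i)" for i
  have "bij_betw ((!) xs) {..<dim_row A} {..<dim_row A}"
    using bij_betw_nth[OF xs(1)] xs(2) len by simp
  then have "bij_betw \<sigma> {..<dim_row A} {..<dim_row A}"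
    by (rule bij_betw_cong[THEN iffD1, rotated]) (simp add: \<sigma>_def)
  then have "\<sigma> permutes {..<dim_row A}"
    by (rule bij_imp_permutes) (simp add: \<sigma>_def)
  moreover have "i < j" if "k < length Is" "l < length Is" "i < dim_row A" "j < dim_row A"
    "k < l" "\<sigma> i \<in> Is ! k" "\<sigma> j \<in> Is ! l" for k l i j
    using that pos[of k "\<sigma> i"] pos[of l "\<sigma> j"] ord[of i j] by (simp add: len \<sigma>_def)
  ultimately show ?thesis unfolding gantmacher_permutation_def using Is by blast
qed

section \<open>Dependence on the type only, and blocks of transitive types\<close>

lemma type_determines_gantmacher:
  assumes A: "A \<in> carrier_mat n n" and B: "B \<in> carrier_mat n n"
    and eq: "pos_edges A = pos_edges B"
  shows "gantmacher_permutation A Is \<sigma> \<longleftrightarrow> gantmacher_permutation B Is \<sigma>"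
    and "num_essential_classes A = num_essential_classes B"
proof -
  have r: "reaches A = reaches B" by (intro ext) (simp add: reaches_def eq)
  have d: "dim_row A = dim_row B" using A B by simp
  have ess: "essential_class A = essential_class B"
    by (intro ext) (simp add: essential_class_def essential_def r d)
  have cl: "comm_classes A = comm_classes B"
    by (simp add: comm_classes_def communicates_def r d)
  show num: "num_essential_classes A = num_essential_classes B"
    by (simp add: num_essential_classes_def ess cl)
  show "gantmacher_permutation A Is \<sigma> \<longleftrightarrow> gantmacher_permutation B Is \<sigma>"
    by (simp add: gantmacher_permutation_def gantmacher_numbering_def class_reaches_def
      num ess cl r d)
qed

lemma same_type_gantmacher_form:
  assumes "A \<in> carrier_mat n n" "B \<in> carrier_mat n n" "same_type A B" "\<sigma> permutes {..<n}"
  shows "same_type (gantmacher_form A \<sigma>) (gantmacher_form B \<sigma>)"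
  using assms permutes_in_image[OF assms(4)] unfolding same_type_def gantmacher_form_def by auto

lemma submatrix_index_in:
  assumes r: "r < dim_row (submatrix A I J)" and c: "c < dim_col (submatrix A I J)"
  shows "submatrix A I J $$ (r, c) = A $$ (pick I r, pick J c)"
    and "pick I r \<in> I" and "pick J c \<in> J"
proof -
  have r': "r < card {i. i < dim_row A \<and> i \<in> I}" and c': "c < card {j. j < dim_col A \<and> j \<in> J}"
    using r c by (simp_all add: dim_submatrix)
  show "submatrix A I J $$ (r, c) = A $$ (pick I r, pick J c)"
    by (rule submatrix_index[OF r' c'])
  show "pick I r \<in> I" "pick J c \<in> J"
    using pick_in_set_le[of r "{i. i < dim_row A \<and> i \<in> I}"] pick_reduce_set[OF r'] r'
      pick_in_set_le[of c "{j. j < dim_col A \<and> j \<in> J}"] pick_reduce_set[OF c'] c'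
    by auto
qed

lemma gantmacher_blocks_of_transitive:
  assumes A: "A \<in> carrier_mat n n" "nonneg_mat A"
    and rfl: "Id_on {..<n} \<subseteq> pos_edges A" and trans: "trans (pos_edges A)"
    and num: "gantmacher_numbering A Is"
  shows "k < length Is \<Longrightarrow> pos_mat (gantmacher_block A Is k k)"
    and "k < length Is \<Longrightarrow> l < length Is \<Longrightarrow>
      pos_mat (gantmacher_block A Is k l) \<or> is_zero_mat (gantmacher_block A Is k l)"
proof -
  have cl: "Is ! k \<in> comm_classes A" if "k < length Is" for k
    using num that nth_mem unfolding gantmacher_numbering_def by blast
  have lt: "i < n" if "i \<in> Is ! k" "k < length Is" for i k
    using comm_class_subset[OF cl[OF that(2)]] that(1) A by auto
  have edge: "reaches A i j \<longleftrightarrow> A $$ (i, j) > 0" if "i < n" "j < n" for i j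
  proof -
    have "(i, j) \<in> (pos_edges A)\<^sup>* \<longleftrightarrow> (i, j) \<in> pos_edges A"
      using rtrancl_trancl_reflcl[of "pos_edges A"] trancl_id[OF trans] rfl that by auto
    then show ?thesis using that A unfolding reaches_def pos_edges_def by auto
  qed
  have comm: "reaches A i j" if "i \<in> Is ! k" "j \<in> Is ! k" "k < length Is" for i j k
    using comm_class_eq_iff[OF cl cl that(1,2)] that(3) unfolding communicates_def by blast
  show "pos_mat (gantmacher_block A Is k k)" if "k < length Is"
    unfolding pos_mat_def gantmacher_block_def
    using submatrix_index_in[of _ A "Is ! k" "Is ! k"] comm edge lt that by metis
  show "pos_mat (gantmacher_block A Is k l) \<or> is_zero_mat (gantmacher_block A Is k l)"
    if k: "k < length Is" and l: "l < length Is"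
  proof (cases "class_reaches A (Is ! k) (Is ! l)")
    case True
    then obtain i j where ij: "i \<in> Is ! k" "j \<in> Is ! l" "reaches A i j"
      unfolding class_reaches_def by blast
    have "A $$ (i', j') > 0" if "i' \<in> Is ! k" "j' \<in> Is ! l" for i' j'
    proof -
      have "reaches A i' j'"
        using comm[OF that(1) ij(1) k] ij(3) comm[OF ij(2) that(2) l] reaches_trans by blast
      then show ?thesis using edge lt that k l by blast
    qed
    then have "pos_mat (gantmacher_block A Is k l)"
      unfolding pos_mat_def gantmacher_block_def
      using submatrix_index_in[of _ A "Is ! k" "Is ! l"] by simp
    then show ?thesis ..
  next
    case False
    have "A $$ (i, j) = 0" if "i \<in> Is ! k" "j \<in> Is ! l" for i j
    proof -
      have "\<not> A $$ (i, j) > 0"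
        using False edge lt that k l unfolding class_reaches_def by blast
      moreover have "A $$ (i, j) \<ge> 0"
        using A lt that k l unfolding nonneg_mat_def by auto
      ultimately show ?thesis by simp
    qed
    then have "is_zero_mat (gantmacher_block A Is k l)"
      unfolding is_zero_mat_def gantmacher_block_def
      using submatrix_index_in[of _ A "Is ! k" "Is ! l"] by (intro eq_matI) simp_all
    then show ?thesis ..
  qed
qed

section \<open>Accumulations of a common type\<close>

theorem proposition1:
  fixes n :: nat and A :: "nat \<Rightarrow> real mat"
  assumes "n \<ge> 1"
    and "\<And>t. A t \<in> carrier_mat n n"
    and "\<And>t. nonneg_mat (A t)"
    and "\<And>t. pos_diagonal (A t)"
  shows "\<exists>t :: nat \<Rightarrow> nat. 0 < t 0 \<and> strict_mono t \<and>
    (let M = (\<lambda>i. backward_acc n A (t (Suc i)) (t i)) in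
      (\<forall>i. same_type (M i) (M 0)) \<and>
      (\<exists>Is \<sigma>. gantmacher_permutation (M 0) Is \<sigma>) \<and>
      (\<forall>Is \<sigma>. gantmacher_permutation (M 0) Is \<sigma> \<longrightarrow>
        (\<forall>i. gantmacher_permutation (M i) Is \<sigma> \<and>
             num_essential_classes (M i) = num_essential_classes (M 0) \<and>
             same_type (gantmacher_form (M i) \<sigma>) (gantmacher_form (M 0) \<sigma>) \<and>
             (\<forall>k<length Is. pos_mat (gantmacher_block (M i) Is k k)) \<and>
             (\<forall>k\<in>{num_essential_classes (M i)..<length Is}. \<forall>l<k.
                pos_mat (gantmacher_block (M i) Is k l) \<or>
                is_zero_mat (gantmacher_block (M i) Is k l)))))"
proof -
  note carrier = backward_acc_carrier[of A, OF assms(2)]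
  note nonneg = backward_acc_nonneg[of A, OF assms(2,3)]
  note refl = backward_acc_edges_refl[of A, OF assms(2-4)]
  have "\<exists>(t :: nat \<Rightarrow> nat) P. 0 < t 0 \<and> strict_mono t \<and>
      (\<forall>i. pos_edges (backward_acc n A (t (Suc i)) (t i)) = P) \<and> trans P"
  proof (rule eventually_constant_transitive_windows[where V = "{..<n}"])
    show "pos_edges (backward_acc n A t s) \<subseteq> {..<n} \<times> {..<n}" if "s \<le> t" for t s
      using carrier_matD(1)[OF carrier[OF that]] by (auto simp: pos_edges_def)
    show "pos_edges (backward_acc n A t s) =
        pos_edges (backward_acc n A t u) O pos_edges (backward_acc n A u s)"
      if "s \<le> u" "u \<le> t" for t u s
      unfolding backward_acc_split[of A, OF assms(2) that]
      by (rule pos_edges_mult[where n = n]) (use carrier nonneg that in auto)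
  qed (use refl in auto)
  then obtain t P where t: "0 < t 0" "strict_mono t"
    and P: "\<And>i. pos_edges (backward_acc n A (t (Suc i)) (t i)) = P" and "trans P"
    by blast
  define M where "M i = backward_acc n A (t (Suc i)) (t i)" for i
  have le: "t i \<le> t (Suc i)" for i using t(2) by (simp add: strict_mono_less_eq)
  have MC: "M i \<in> carrier_mat n n" and MN: "nonneg_mat (M i)"
    and MR: "Id_on {..<n} \<subseteq> pos_edges (M i)" for i
    unfolding M_def using le carrier nonneg refl by blast+
  have MP: "pos_edges (M i) = P" for i unfolding M_def by (rule P)
  have ST: "same_type (M i) (M 0)" for i
    by (simp add: same_type_iff_pos_edges[OF MC MC] MP)
  have "gantmacher_permutation (M i) Is \<sigma> \<and>
     num_essential_classes (M i) = num_essential_classes (M 0) \<and>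
     same_type (gantmacher_form (M i) \<sigma>) (gantmacher_form (M 0) \<sigma>) \<and>
     (\<forall>k<length Is. pos_mat (gantmacher_block (M i) Is k k)) \<and>
     (\<forall>k\<in>{num_essential_classes (M i)..<length Is}. \<forall>l<k.
        pos_mat (gantmacher_block (M i) Is k l) \<or> is_zero_mat (gantmacher_block (M i) Is k l))"
    if gp0: "gantmacher_permutation (M 0) Is \<sigma>" for Is \<sigma> i
  proof -
    note det = type_determines_gantmacher[OF MC[of i] MC[of 0]]
    have gp: "gantmacher_permutation (M i) Is \<sigma>" using gp0 det(1) MP by simp
    then have num: "gantmacher_numbering (M i) Is" and "\<sigma> permutes {..<n}"
      using MC[of i] unfolding gantmacher_permutation_def by auto
    have trans: "trans (pos_edges (M i))" using \<open>trans P\<close> MP by simp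
    note blocks = gantmacher_blocks_of_transitive[OF MC MN MR trans num]
    show ?thesis
      using gp det(2) MP same_type_gantmacher_form[OF MC MC ST \<open>\<sigma> permutes {..<n}\<close>] blocks
      by auto
  qed
  with t ST gantmacher_permutation_exists[of "M 0"] show ?thesis
    unfolding Let_def M_def by (intro exI[of _ t] conjI allI impI) blast+
qed

end
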